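(* The maximal cardinality of $\mathrm{End}_2(q)$ as $q$ varies over $\mathrm{Conf}^4(\mathbb{C})$ is $E_{4,2} = 28$. This cardinality is achieved by a unique affine equivalence class of configurations (considered as unordered sets of four points), namely the class represented by $q = \mu_4 := (1,i,-1,-i)$, the 4th roots of unity.
   Context: $\mathrm{Conf}^4(\mathbb{C})$ is the set of $4$-tuples $q=(q_1,q_2,q_3,q_4)$ of pairwise distinct complex numbers. $\mathrm{End}_2(q)$ is the set of polynomials $f(x)\in\mathbb{C}[x]$ of degree exactly $2$ such that $f(\{q_1,\ldots,q_4\})\subseteq\{q_1,\ldots,q_4\}$; it does not depend on the ordering of the $q_i$. $E_{4,2}$ denotes the maximum of $|\mathrm{End}_2(q)|$ over all $q\in\mathrm{Conf}^4(\mathbb{C})$. Two configurations are affine equivalent if one is carried to the other by a map $\ell(x)=ax+b$ with $a\neq0$. *)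

theory Defs
  imports Complex_Main "HOL-Computational_Algebra.Polynomial"
begin

definition Conf :: "nat \<Rightarrow> complex list set" where
  "Conf n = {q. length q = n \<and> distinct q}"

definition Endo :: "nat \<Rightarrow> complex list \<Rightarrow> complex poly set" where
  "Endo d q = {f. degree f = d \<and> poly f ` set q \<subseteq> set q}"

text \<open>
  \<open>card\<close> is 0 on infinite sets and \<open>Max\<close> is unspecified on infinite sets, so \<open>E_max\<close> is
  the maximal cardinality only when every \<open>Endo d q\<close> is finite and the cardinalities
  are bounded.
\<close>
definition E_max :: "nat \<Rightarrow> nat \<Rightarrow> nat" where
  "E_max n d = Max ((\<lambda>q. card (Endo d q)) ` Conf n)"

text \<open>
  Affine equivalence of unordered configurations: it is applied to \<open>set q\<close>, so the map
  need not respect the order of the points.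
\<close>
definition affine_equiv :: "complex set \<Rightarrow> complex set \<Rightarrow> bool" where
  "affine_equiv A B \<longleftrightarrow> (\<exists>a b. a \<noteq> 0 \<and> (\<lambda>x. a * x + b) ` A = B)"

definition mu4 :: "complex list" where
  "mu4 = [1, \<i>, -1, -\<i>]"

end

theory Submission
  imports Defs
begin

text \<open>
  A polynomial of degree at most \<open>2\<close> is determined by its values on four points, and a value tuple
  arises in this way exactly when its third divided difference vanishes. Thus the endomorphisms
  of degree at most \<open>2\<close> of a configuration \<open>S\<close> correspond to the solutions in \<open>S\<close> of one linear
  equation \<open>w1 x + w2 y + w3 z + w4 u = 0\<close> with nonzero coefficients. At
  least five of them, the constants and the identity, have degree at most \<open>1\<close>. Hence a
  configuration with at most \<open>32\<close> solutions has at most \<open>27\<close> quadratic endomorphisms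
  (\<open>quad_endos_bound\<close>).

  Two applications of \<open>2 m n \<le> m\<^sup>2 + n\<^sup>2\<close> to fibre cardinalities bound the number of solutions by
  the additive energy of \<open>S\<close>, the number of solutions of \<open>a - b = c - d\<close>
  (\<open>card_relations_le_energy\<close>). If the nonzero differences of \<open>S\<close> are distinct, the energy is \<open>28\<close>.
  Otherwise \<open>S\<close> contains a three-term progression or is a parallelogram, and an affine map
  leaves a single parameter \<open>t\<close>.

  For \<open>{-1, 0, 1, t}\<close> the energy is \<open>32\<close>, except for six values of \<open>t\<close> at which the solutions can be
  counted one by one (\<open>quad_endos_progression\<close>). For \<open>{1, -1, t, -t}\<close> without a progression the
  equation becomes \<open>t (x - y) = z - u\<close>, and its number of solutions is at most \<open>30\<close> unless
  multiplication by \<open>t\<close> permutes the directions of the sides, that is unless \<open>t\<^sup>2 = -1\<close> and the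
  parallelogram is a square (\<open>quad_endos_parallelogram\<close>). The square has exactly \<open>28\<close> quadratic
  endomorphisms (\<open>card_quad_endos_mu4\<close>), and conjugation by affine maps shows that so has every
  configuration in its class.
\<close>

section \<open>Quadratic endomorphisms as solutions of one linear equation\<close>

definition quad_endos :: "complex set \<Rightarrow> complex poly set" where
  "quad_endos S = {f. degree f = 2 \<and> poly f ` S \<subseteq> S}"

text \<open>
  Read as value tuples \<open>((x, y), (z, u))\<close> of a function on four points. The values are grouped in
  two pairs because the energy estimate separates the first two from the last two.
\<close>

definition relations ::
    "complex \<times> complex \<times> complex \<times> complex \<Rightarrow> complex set
      \<Rightarrow> ((complex \<times> complex) \<times> (complex \<times> complex)) set" where
  "relations w S = (case w of (w1, w2, w3, w4) \<Rightarrow>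
     {((x, y), (z, u)) \<in> (S \<times> S) \<times> (S \<times> S). w1 * x + w2 * y + w3 * z + w4 * u = 0})"

definition diff_count :: "complex set \<Rightarrow> complex \<Rightarrow> nat" where
  "diff_count S e = card {(x, y) \<in> S \<times> S. x - y = e}"

text \<open>
  The additive energy of additive combinatorics.
\<close>

definition energy :: "complex set \<Rightarrow> nat" where
  "energy S = card {((a, b), (c, d)) \<in> (S \<times> S) \<times> (S \<times> S). a - b = c - d}"

lemma poly_degree_2:
  fixes f :: "'a :: comm_ring_1 poly"
  assumes "degree f \<le> 2"
  shows "poly f x = coeff f 0 + coeff f 1 * x + coeff f 2 * x\<^sup>2"
proof -
  have "poly f x = (\<Sum>i\<le>2. coeff f i * x ^ i)"
    by (subst poly_altdef, rule sum.mono_neutral_left) (use assms in \<open>auto simp: coeff_eq_0\<close>)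
  then show ?thesis by (simp add: numeral_2_eq_2)
qed

text \<open>
  A polynomial of degree at most \<open>2\<close> is determined by its values at the four points, and any
  functional \<open>w\<close> that kills \<open>1\<close>, \<open>x\<close> and \<open>x\<^sup>2\<close> on these points kills its value tuple. The set \<open>L\<close>
  collects maps of degree at most \<open>1\<close>: they solve the same equation, so each of them
  improves the bound on the quadratic maps by one.
\<close>

lemma quad_endos_count:
  fixes a b c d :: complex
  defines "S \<equiv> {a, b, c, d}"
  assumes dist: "distinct [a, b, c, d]"
    and w0: "w1 + w2 + w3 + w4 = 0"
    and w1: "w1 * a + w2 * b + w3 * c + w4 * d = 0"
    and w2: "w1 * a\<^sup>2 + w2 * b\<^sup>2 + w3 * c\<^sup>2 + w4 * d\<^sup>2 = 0"
    and L: "\<And>f. f \<in> L \<Longrightarrow> degree f \<le> 1 \<and> poly f ` S \<subseteq> S"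
  shows "finite (quad_endos S)"
    and "card (quad_endos S) + card L \<le> card (relations (w1, w2, w3, w4) S)"
proof -
  define ev where "ev f = ((poly f a, poly f b), (poly f c, poly f d))" for f
  have deg: "degree f \<le> 2" if "f \<in> quad_endos S \<union> L" for f
    using that L[of f] by (auto simp: quad_endos_def)
  have inj: "inj_on ev (quad_endos S \<union> L)"
  proof (rule inj_onI)
    fix f g assume f: "f \<in> quad_endos S \<union> L" and g: "g \<in> quad_endos S \<union> L" and "ev f = ev g"
    then have eq: "poly f x = poly g x" if "x \<in> S" for x
      using that by (auto simp: ev_def S_def)
    have "card S = 4" using dist by (simp add: S_def)
    then show "f = g"
      using poly_eqI_degree[of S f g] eq deg[OF f] deg[OF g] by simp
  qed
  have sub: "ev ` (quad_endos S \<union> L) \<subseteq> relations (w1, w2, w3, w4) S"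
  proof
    fix y assume "y \<in> ev ` (quad_endos S \<union> L)"
    then obtain f where f: "f \<in> quad_endos S \<union> L" and y: "y = ev f" by auto
    have mem: "poly f ` S \<subseteq> S" using f L[of f] by (auto simp: quad_endos_def)
    have "w1 * poly f a + w2 * poly f b + w3 * poly f c + w4 * poly f d
        = coeff f 0 * (w1 + w2 + w3 + w4)
        + coeff f 1 * (w1 * a + w2 * b + w3 * c + w4 * d)
        + coeff f 2 * (w1 * a\<^sup>2 + w2 * b\<^sup>2 + w3 * c\<^sup>2 + w4 * d\<^sup>2)"
      unfolding poly_degree_2[OF deg[OF f]] by (simp add: algebra_simps)
    also have "\<dots> = 0" by (simp add: w0 w1 w2)
    finally have "w1 * poly f a + w2 * poly f b + w3 * poly f c + w4 * poly f d = 0" .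
    moreover have "poly f a \<in> S" "poly f b \<in> S" "poly f c \<in> S" "poly f d \<in> S"
      using mem by (simp_all add: S_def)
    ultimately show "y \<in> relations (w1, w2, w3, w4) S"
      by (simp add: y ev_def relations_def)
  qed
  have fin: "finite (relations (w1, w2, w3, w4) S)"
  proof (rule finite_subset)
    show "relations (w1, w2, w3, w4) S \<subseteq> (S \<times> S) \<times> (S \<times> S)"
      by (auto simp: relations_def)
    show "finite ((S \<times> S) \<times> (S \<times> S))" by (simp add: S_def)
  qed
  have finU: "finite (quad_endos S \<union> L)"
    using inj_on_finite[OF inj sub fin] .
  then show "finite (quad_endos S)" by simp
  have "quad_endos S \<inter> L = {}"
    using L by (fastforce simp: quad_endos_def)
  then have "card (quad_endos S) + card L = card (quad_endos S \<union> L)"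
    using finU by (simp add: card_Un_disjoint)
  also have "\<dots> \<le> card (relations (w1, w2, w3, w4) S)"
    using card_inj_on_le[OF inj sub fin] .
  finally show "card (quad_endos S) + card L \<le> card (relations (w1, w2, w3, w4) S)" .
qed

lemma card_constants_and_identity:
  fixes S :: "complex set"
  assumes "finite S"
  shows "card (insert [:0, 1:] ((\<lambda>s. [:s:]) ` S)) = Suc (card S)"
proof -
  have "card ((\<lambda>s. [:s:]) ` S) = card S" by (rule card_image) (auto simp: inj_on_def)
  moreover have "[:0, 1:] \<notin> (\<lambda>s. [:s:]) ` S" by auto
  ultimately show ?thesis using assms by simp
qed

text \<open>
  The constants and the identity preserve every configuration, which accounts for the \<open>5\<close>.
\<close>

lemma quad_endos_bound:
  assumes dist: "distinct [a, b, c, d]"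
    and w: "w1 + w2 + w3 + w4 = 0"
      "w1 * a + w2 * b + w3 * c + w4 * d = 0"
      "w1 * a\<^sup>2 + w2 * b\<^sup>2 + w3 * c\<^sup>2 + w4 * d\<^sup>2 = 0"
  shows "card (quad_endos {a, b, c, d}) + 5 \<le> card (relations (w1, w2, w3, w4) {a, b, c, d})"
proof -
  let ?S = "{a, b, c, d}"
  let ?L = "insert [:0, 1:] ((\<lambda>s. [:s:]) ` ?S)"
  have L: "degree f \<le> 1 \<and> poly f ` ?S \<subseteq> ?S" if "f \<in> ?L" for f
    using that by auto
  have "card ?L = Suc (card ?S)"
    by (rule card_constants_and_identity) simp
  also have "\<dots> = 5" using dist by simp
  finally have "card ?L = 5" .
  moreover have "card (quad_endos ?S) + card ?L \<le> card (relations (w1, w2, w3, w4) ?S)"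
    by (rule quad_endos_count(2)[OF dist w]) (rule L)
  ultimately show ?thesis by linarith
qed

text \<open>
  Conjugation by an affine map preserves the degree.
\<close>

lemma card_quad_endos_affine:
  assumes "a \<noteq> 0"
  shows "card (quad_endos ((\<lambda>x. a * x + b) ` S)) = card (quad_endos S)"
proof -
  define A where "A = [:b, a:]"
  define B where "B = [:- b / a, 1 / a:]"
  have inv: "poly A (poly B x) = x" "poly B (poly A x) = x" for x
    using assms by (simp_all add: A_def B_def field_simps)
  have deg: "degree A = 1" "degree B = 1" using assms by (simp_all add: A_def B_def)
  have img: "(\<lambda>x. a * x + b) ` S = poly A ` S" by (simp add: A_def ac_simps)
  have "bij_betw (\<lambda>f. A \<circ>\<^sub>p (f \<circ>\<^sub>p B)) (quad_endos S) (quad_endos (poly A ` S))"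
    by (rule bij_betw_byWitness[where f' = "\<lambda>f. B \<circ>\<^sub>p (f \<circ>\<^sub>p A)"])
       (auto simp: quad_endos_def degree_pcompose deg poly_pcompose inv image_subset_iff
          simp flip: poly_eq_poly_eq_iff)
  then show ?thesis unfolding img by (metis bij_betw_same_card)
qed

section \<open>Additive energy bounds the number of relations\<close>

lemma card_coincidences:
  assumes "finite A" "finite B" "finite V" "h ` A \<subseteq> V"
  shows "card {(x, y) \<in> A \<times> B. h x = k y}
      = (\<Sum>v\<in>V. card {x \<in> A. h x = v} * card {y \<in> B. k y = v})"
proof -
  have "{(x, y) \<in> A \<times> B. h x = k y} = (\<Union>v\<in>V. {x \<in> A. h x = v} \<times> {y \<in> B. k y = v})"
    using assms(4) by auto
  also have "card \<dots> = (\<Sum>v\<in>V. card ({x \<in> A. h x = v} \<times> {y \<in> B. k y = v}))"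
    by (rule card_UN_disjoint) (use assms in auto)
  finally show ?thesis by (simp add: card_cartesian_product)
qed

text \<open>
  With \<open>m\<^sub>v\<close> and \<open>n\<^sub>v\<close> the sizes of the fibres of \<open>f\<close> and \<open>g\<close> over \<open>v\<close>, the three cardinalities
  are the sums of \<open>m\<^sub>v n\<^sub>v\<close>, \<open>m\<^sub>v\<^sup>2\<close> and \<open>n\<^sub>v\<^sup>2\<close>; so this is \<open>2 m n \<le> m\<^sup>2 + n\<^sup>2\<close>.
\<close>

lemma card_coincidences_le:
  assumes "finite X" "finite Y"
  shows "2 * card {(x, y) \<in> X \<times> Y. f x = g y}
    \<le> card {(x, x') \<in> X \<times> X. f x = f x'} + card {(y, y') \<in> Y \<times> Y. g y = g y'}"
proof -
  define V where "V = f ` X \<union> g ` Y"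
  have V: "finite V" "f ` X \<subseteq> V" "g ` Y \<subseteq> V" using assms by (auto simp: V_def)
  have amgm: "2 * (m * n) \<le> m * m + n * n" for m n :: nat
  proof (cases "m \<le> n")
    case True
    then obtain k where "n = m + k" using le_Suc_ex by blast
    then show ?thesis by (simp add: algebra_simps)
  next
    case False
    then obtain k where "m = n + k" using le_Suc_ex nat_le_linear by blast
    then show ?thesis by (simp add: algebra_simps)
  qed
  have "2 * card {(x, y) \<in> X \<times> Y. f x = g y}
      = (\<Sum>v\<in>V. 2 * (card {x \<in> X. f x = v} * card {y \<in> Y. g y = v}))"
    unfolding card_coincidences[OF assms V(1,2)] by (rule sum_distrib_left)
  also have "\<dots> \<le> (\<Sum>v\<in>V. card {x \<in> X. f x = v} * card {x \<in> X. f x = v}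
      + card {y \<in> Y. g y = v} * card {y \<in> Y. g y = v})"
    by (intro sum_mono amgm)
  also have "\<dots> = card {(x, x') \<in> X \<times> X. f x = f x'} + card {(y, y') \<in> Y \<times> Y. g y = g y'}"
    unfolding card_coincidences[OF assms(1,1) V(1,2)] card_coincidences[OF assms(2,2) V(1,3)]
    by (rule sum.distrib)
  finally show ?thesis .
qed

text \<open>
  Sorting the equation by coefficients turns it into a coincidence
  \<open>w1 (x - x') = w2 (y' - y)\<close> between two dilated differences, and a nonzero dilation does not
  change the energy.
\<close>

lemma card_dilate_energy_le:
  assumes "finite S" "w1 \<noteq> 0" "w2 \<noteq> (0 :: complex)"
  shows "card {((x, y), (x', y')) \<in> (S \<times> S) \<times> (S \<times> S). w1 * x + w2 * y = w1 * x' + w2 * y'}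
    \<le> energy S"
proof -
  let ?A = "{((x, y), (x', y')) \<in> (S \<times> S) \<times> (S \<times> S). w1 * x + w2 * y = w1 * x' + w2 * y'}"
  let ?B = "{(p, p') \<in> (S \<times> S) \<times> (S \<times> S). w1 * (fst p - snd p) = w2 * (fst p' - snd p')}"
  have diff: "w1 * x + w2 * y = w1 * x' + w2 * y' \<longleftrightarrow> w1 * (x - x') = w2 * (y' - y)" for x y x' y'
    by (rule iffI) algebra+
  have "bij_betw (\<lambda>((x, y), (x', y')). ((x, x'), (y', y))) ?A ?B"
    by (rule bij_betw_byWitness[where f' = "\<lambda>((x, x'), (y', y)). ((x, y), (x', y'))"])
       (auto simp: diff)
  then have "2 * card ?A = 2 * card ?B" by (simp add: bij_betw_same_card)
  also have "\<dots> \<le> card {(p, p') \<in> (S \<times> S) \<times> (S \<times> S). w1 * (fst p - snd p) = w1 * (fst p' - snd p')}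
      + card {(p, p') \<in> (S \<times> S) \<times> (S \<times> S). w2 * (fst p - snd p) = w2 * (fst p' - snd p')}"
    by (rule card_coincidences_le) (use assms in auto)
  also have "\<dots> = 2 * energy S"
    using assms by (simp add: energy_def case_prod_unfold mem_Times_iff)
  finally show ?thesis by simp
qed

text \<open>
  The comparison of coincidences is applied to \<open>w1 x + w2 y = - (w3 z + w4 u)\<close>; both resulting
  self-coincidence counts are covered by the previous lemma.
\<close>

lemma card_relations_le_energy:
  assumes "finite S" "w1 \<noteq> 0" "w2 \<noteq> 0" "w3 \<noteq> 0" "w4 \<noteq> 0"
  shows "card (relations (w1, w2, w3, w4) S) \<le> energy S"
proof -
  define f where "f p = w1 * fst p + w2 * snd p" for p
  define g where "g p = - w3 * fst p + - w4 * snd p" for p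
  have "relations (w1, w2, w3, w4) S = {(p, p') \<in> (S \<times> S) \<times> (S \<times> S). f p = g p'}"
    by (auto simp: relations_def f_def g_def algebra_simps eq_neg_iff_add_eq_0)
  then have "2 * card (relations (w1, w2, w3, w4) S)
      \<le> card {(p, p') \<in> (S \<times> S) \<times> (S \<times> S). f p = f p'}
       + card {(p, p') \<in> (S \<times> S) \<times> (S \<times> S). g p = g p'}"
    using card_coincidences_le[of "S \<times> S" "S \<times> S" f g] assms by simp
  also have "\<dots> \<le> 2 * energy S"
    using card_dilate_energy_le[of S w1 w2] card_dilate_energy_le[of S "- w3" "- w4"] assms
    by (simp add: f_def g_def case_prod_unfold mem_Times_iff)
  finally show ?thesis by simp
qed

lemma quad_endos_le_energy:
  assumes "distinct [a, b, c, d]"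
  shows "card (quad_endos {a, b, c, d}) + 5 \<le> energy {a, b, c, d}"
proof -
  \<comment> \<open>The weights of the third divided difference, multiplied by the Vandermonde determinant.\<close>
  let ?w1 = "(b - c) * (b - d) * (c - d)" and ?w2 = "- ((a - c) * (a - d) * (c - d))"
  and ?w3 = "(a - b) * (a - d) * (b - d)" and ?w4 = "- ((a - b) * (a - c) * (b - c))"
  have "card (quad_endos {a, b, c, d}) + 5 \<le> card (relations (?w1, ?w2, ?w3, ?w4) {a, b, c, d})"
    by (rule quad_endos_bound[OF assms]; simp add: algebra_simps power2_eq_square)
  also have "\<dots> \<le> energy {a, b, c, d}"
    by (rule card_relations_le_energy) (use assms in auto)
  finally show ?thesis .
qed

text \<open>
  Only the \<open>4 * 4\<close> quadruples \<open>a - a = c - c\<close> and the \<open>4 * 3\<close> quadruples \<open>a - b = a - b\<close> with \<open>a \<noteq> b\<close>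
  remain when no nonzero difference has two representations.
\<close>

lemma energy_le_28:
  assumes "card S = 4"
    and "\<And>a b c d. \<lbrakk>a \<in> S; b \<in> S; c \<in> S; d \<in> S; a - b = c - d\<rbrakk> \<Longrightarrow> a = b \<or> a = c"
  shows "energy S \<le> 28"
proof -
  have fin: "finite S" using assms(1) by (simp add: card_ge_0_finite)
  define A where "A = (\<lambda>(a, c). ((a, a), (c, c))) ` (S \<times> S)"
  define B where "B = (\<lambda>(a, b). ((a, b), (a, b))) ` {(a, b) \<in> S \<times> S. a \<noteq> b}"
  have "{(a, b) \<in> S \<times> S. a \<noteq> b} = S \<times> S - (\<lambda>a. (a, a)) ` S" by auto
  moreover have "card (S \<times> S - (\<lambda>a. (a, a)) ` S) = 12"
    using fin assms(1)
    by (subst card_Diff_subset) (auto simp: card_image inj_on_def card_cartesian_product)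
  ultimately have B: "card B \<le> 12"
    using card_image_le[of "{(a, b) \<in> S \<times> S. a \<noteq> b}" "\<lambda>(a, b). ((a, b), (a, b))"] fin
    unfolding B_def by simp
  have A: "card A \<le> 16"
    using card_image_le[of "S \<times> S" "\<lambda>(a, c). ((a, a), (c, c))"] fin assms(1)
    unfolding A_def by (simp add: card_cartesian_product)
  have sub: "{((a, b), (c, d)) \<in> (S \<times> S) \<times> (S \<times> S). a - b = c - d} \<subseteq> A \<union> B"
  proof clarify
    fix a b c d assume "a \<in> S" "b \<in> S" "c \<in> S" "d \<in> S" "a - b = c - d"
      "((a, b), (c, d)) \<notin> B"
    then show "((a, b), (c, d)) \<in> A"
      using assms(2)[of a b c d] by (force simp: A_def B_def)
  qed
  have "energy S \<le> card (A \<union> B)"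
    unfolding energy_def by (rule card_mono[OF _ sub])
       (use fin in \<open>auto simp: A_def B_def intro: finite_subset[of _ "S \<times> S"]\<close>)
  also have "\<dots> \<le> 28"
    using card_Un_le[of A B] A B by linarith
  finally show ?thesis .
qed

section \<open>Counting through representations of differences\<close>

lemma card_quadruples:
  assumes "finite S"
  shows "card {((x, y), (z, u)) \<in> (S \<times> S) \<times> (S \<times> S). P x y z u}
    = (\<Sum>x\<in>S. \<Sum>y\<in>S. card {(z, u) \<in> S \<times> S. P x y z u})"
proof -
  have "{((x, y), (z, u)) \<in> (S \<times> S) \<times> (S \<times> S). P x y z u}
      = (SIGMA p : S \<times> S. {(z, u) \<in> S \<times> S. P (fst p) (snd p) z u})"
    by auto
  moreover have "finite {(z, u) \<in> S \<times> S. P x y z u}" for x y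
    by (rule finite_subset[of _ "S \<times> S"]) (use assms in auto)
  ultimately show ?thesis
    using assms by (simp add: card_SigmaI sum.cartesian_product case_prod_unfold)
qed

lemma card_pairs:
  assumes "finite S"
  shows "card {(z, u) \<in> S \<times> S. P z u} = (\<Sum>z\<in>S. \<Sum>u\<in>S. of_bool (P z u))"
proof -
  have "{(z, u) \<in> S \<times> S. P z u} = (SIGMA z : S. {u \<in> S. P z u})" by auto
  then show ?thesis
    using assms by (simp add: card_SigmaI Int_def)
qed

lemma card_relations_eq_sum:
  assumes "finite S"
  shows "card (relations (w1, w2, w3, w4) S)
    = (\<Sum>x\<in>S. \<Sum>y\<in>S. \<Sum>z\<in>S. \<Sum>u\<in>S. of_bool (w1 * x + w2 * y + w3 * z + w4 * u = 0))"
  unfolding relations_def prod.case card_quadruples[OF assms] card_pairs[OF assms] ..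

lemma energy_eq_sum_diff_count:
  assumes "finite S"
  shows "energy S = (\<Sum>a\<in>S. \<Sum>b\<in>S. diff_count S (a - b))"
  unfolding energy_def diff_count_def card_quadruples[OF assms] by (simp add: eq_commute)

lemma diff_count_minus: "diff_count S (- e) = diff_count S e"
  unfolding diff_count_def
  by (rule bij_betw_same_card[of "\<lambda>(x, y). (y, x)"],
      rule bij_betw_byWitness[where f' = "\<lambda>(x, y). (y, x)"]) (auto simp: algebra_simps)

lemma diff_count_0: "diff_count S 0 = card S"
  unfolding diff_count_def
  by (rule bij_betw_same_card[of fst], rule bij_betw_byWitness[where f' = "\<lambda>x. (x, x)"]) auto

lemma sum_differences:
  fixes a b c d :: complex and F :: "complex \<Rightarrow> nat"
  assumes "distinct [a, b, c, d]" and "\<And>e. F (- e) = F e"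
  shows "(\<Sum>x\<in>{a, b, c, d}. \<Sum>y\<in>{a, b, c, d}. F (x - y))
    = 4 * F 0 + 2 * (F (a - b) + F (a - c) + F (a - d) + F (b - c) + F (b - d) + F (c - d))"
proof -
  have "F (y - x) = F (x - y)" for x y using assms(2)[of "x - y"] by simp
  note sym = this[of b a] this[of c a] this[of d a] this[of c b] this[of d b] this[of d c]
  show ?thesis using assms(1) by (simp add: sym)
qed

lemma diff_count_nonzero:
  assumes "distinct [a, b, c, d]" "e \<noteq> 0"
  shows "diff_count {a, b, c, d} e
    = of_bool (a - b = e) + of_bool (b - a = e) + of_bool (a - c = e) + of_bool (c - a = e)
    + of_bool (a - d = e) + of_bool (d - a = e) + of_bool (b - c = e) + of_bool (c - b = e)
    + of_bool (b - d = e) + of_bool (d - b = e) + of_bool (c - d = e) + of_bool (d - c = e)"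
proof -
  have "0 \<noteq> e" using assms(2) by simp
  then show ?thesis
    unfolding diff_count_def using assms(1) by (subst card_pairs) simp_all
qed

section \<open>Configurations containing a three-term progression\<close>

text \<open>
  The excluded values of \<open>t\<close> repeat a point or make two of the differences \<open>1\<close>, \<open>2\<close>, \<open>t\<close>, \<open>t - 1\<close>,
  \<open>t + 1\<close> agree up to sign. For all others only \<open>1\<close> and \<open>-1\<close> have two representations, and
  \<open>32 = 16 + 2 * 2\<^sup>2 + 8\<close>.
\<close>

lemma progression_energy_le:
  assumes "t \<notin> {0, 1, -1, 2, -2, 3, -3, 1/2, -1/2}"
  shows "energy {-1, 0, 1, t} \<le> 32"
proof -
  let ?r = "diff_count {-1, 0, 1, t}"
  have dist: "distinct [-1, 0, 1, t]" using assms by auto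
  have gen: "distinct [1, -1, 2, -2, t, -t, t - 1, 1 - t, t + 1, - t - 1]"
    using assms by (auto simp: complex_eq_iff)
  have r: "?r e = 2 * of_bool (e = 1) + 2 * of_bool (e = -1) + of_bool (e = 2) + of_bool (e = -2)
      + of_bool (e = t) + of_bool (e = - t) + of_bool (e = t - 1) + of_bool (e = 1 - t)
      + of_bool (e = t + 1) + of_bool (e = - t - 1)" if "e \<noteq> 0" for e
    unfolding diff_count_nonzero[OF dist that] by (auto simp: eq_commute[of _ e])
  have "energy {-1, 0, 1, t} = 4 * ?r 0
      + 2 * (?r (-1) + ?r (-2) + ?r (-1 - t) + ?r (-1) + ?r (- t) + ?r (1 - t))"
    using sum_differences[OF dist, of ?r] by (simp add: energy_eq_sum_diff_count diff_count_minus)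
  also have "?r 0 = 4" using dist by (simp add: diff_count_0)
  also have "?r (-1) = 2" using gen by (subst r) auto
  also have "?r (-2) = 1" using gen by (subst r) auto
  also have "?r (-1 - t) = 1" using gen by (subst r) (auto simp: complex_eq_iff)
  also have "?r (- t) = 1" using gen by (subst r) auto
  also have "?r (1 - t) = 1" using gen by (subst r) auto
  finally show ?thesis by simp
qed

text \<open>
  At the exceptional parameters the energy is too large to be useful (it is \<open>36\<close> or \<open>44\<close>), and the
  relations themselves are counted, with explicit weights of the third divided difference.
\<close>

lemma quad_endos_progression_2: "card (quad_endos {-1, 0, 1, 2}) \<le> 27"
proof -
  have "card (quad_endos {-1, 0, 1, 2}) + 5 \<le> card (relations (-1, 3, -3, 1) {-1, 0, 1, 2})"
    by (rule quad_endos_bound) simp_all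
  also have "\<dots> \<le> 32" by (simp add: card_relations_eq_sum)
  finally show ?thesis by simp
qed

lemma quad_endos_progression_3: "card (quad_endos {-1, 0, 1, 3}) \<le> 27"
proof -
  have "card (quad_endos {-1, 0, 1, 3}) + 5 \<le> card (relations (-3, 8, -6, 1) {-1, 0, 1, 3})"
    by (rule quad_endos_bound) simp_all
  also have "\<dots> \<le> 32" by (simp add: card_relations_eq_sum)
  finally show ?thesis by simp
qed

lemma quad_endos_progression_half: "card (quad_endos {-1, 0, 1, 1/2}) \<le> 27"
proof -
  have "card (quad_endos {-1, 0, 1, 1/2}) + 5 \<le> card (relations (1, -6, -3, 8) {-1, 0, 1, 1/2})"
    by (rule quad_endos_bound) (simp_all add: power2_eq_square)
  also have "\<dots> \<le> 32" by (simp add: card_relations_eq_sum)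
  finally show ?thesis by simp
qed

lemma quad_endos_progression:
  assumes "t \<notin> {0, 1, -1}"
  shows "card (quad_endos {-1, 0, 1, t}) \<le> 27"
proof -
  have neg: "card (quad_endos {-1, 0, 1, - s}) = card (quad_endos {-1, 0, 1, s})" for s
    using card_quad_endos_affine[of "-1" 0 "{-1, 0, 1, s}"] by (simp add: insert_commute)
  show ?thesis
  proof (cases "t \<in> {2, -2, 3, -3, 1/2, -1/2}")
    case True
    then show ?thesis
      by (elim insertE emptyE; hypsubst; use quad_endos_progression_2 quad_endos_progression_3
        quad_endos_progression_half neg[of 2] neg[of 3] neg[of "1/2"] in simp)
  next
    case False
    then have "energy {-1, 0, 1, t} \<le> 32" using assms by (intro progression_energy_le) auto
    moreover have "card (quad_endos {-1, 0, 1, t}) + 5 \<le> energy {-1, 0, 1, t}"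
      using assms by (intro quad_endos_le_energy) auto
    ultimately show ?thesis by simp
  qed
qed

section \<open>Parallelograms\<close>

text \<open>
  The energy of a parallelogram is at least \<open>36\<close>, which is not enough, so the relations are
  counted exactly. Up to a factor the weights on \<open>1, -1, t, -t\<close> are \<open>t, -t, -1, 1\<close>, so that a relation
  is a coincidence \<open>t (x - y) = z - u\<close> and the count is the sum over \<open>x, y\<close> of the number of
  representations of \<open>t (x - y)\<close> as a difference. If no three points are in progression, the
  differences \<open>2\<close>, \<open>2 t\<close> have one representation and \<open>1 - t\<close>, \<open>1 + t\<close> have two, also up to sign.
  The count is large only if multiplication by \<open>t\<close> takes both of the latter to differences again.
  For \<open>t\<^sup>2 = -1\<close> it swaps them up to sign; otherwise, if one of \<open>t (1 - t)\<close>, \<open>t (1 + t)\<close> has two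
  representations, then \<open>t\<close> satisfies a quadratic equation under which the other has none.
\<close>

lemma quad_endos_parallelogram:
  assumes t: "t \<notin> {0, 1, -1, 3, -3, 1/3, -1/3}" and "t\<^sup>2 \<noteq> -1"
  shows "card (quad_endos {1, -1, t, - t}) \<le> 27"
proof -
  let ?S = "{1, -1, t, - t}" and ?r = "diff_count {1, -1, t, - t}"
  have dist: "distinct [1, -1, t, - t]" using t by (auto simp: complex_eq_iff)
  have gen: "distinct [2, -2, 2 * t, - 2 * t, 1 - t, t - 1, 1 + t, - 1 - t]"
    using t by (auto simp: complex_eq_iff)
  have r: "?r e = of_bool (e = 2) + of_bool (e = -2) + of_bool (e = 2 * t) + of_bool (e = - 2 * t)
      + 2 * of_bool (e = 1 - t) + 2 * of_bool (e = t - 1)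
      + 2 * of_bool (e = 1 + t) + 2 * of_bool (e = - 1 - t)" if "e \<noteq> 0" for e
    unfolding diff_count_nonzero[OF dist that] by (auto simp: eq_commute[of _ e])
  have r_le: "?r e \<le> 2" if "e \<noteq> 0" for e
    using gen unfolding r[OF that] by (auto simp: of_bool_def)
  have r_2: "e \<in> {1 - t, t - 1, 1 + t, - 1 - t}" if "e \<noteq> 0" "?r e = 2" for e
    using gen that(2) unfolding r[OF that(1)] by (auto simp: of_bool_def split: if_splits)
  have r_1: "e \<in> {2, -2, 2 * t, - 2 * t, 1 - t, t - 1, 1 + t, - 1 - t}"
    if "e \<noteq> 0" "?r e \<noteq> 0" for e
    using that(2) unfolding r[OF that(1)] by (auto simp: of_bool_def split: if_splits)
  have nz: "2 * t\<^sup>2 \<noteq> 0" "t - t\<^sup>2 \<noteq> 0" "t + t\<^sup>2 \<noteq> 0"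
  proof -
    show "2 * t\<^sup>2 \<noteq> 0" using t by simp
    have "t - t\<^sup>2 = t * (1 - t)" "t + t\<^sup>2 = t * (1 + t)" by algebra+
    then show "t - t\<^sup>2 \<noteq> 0" "t + t\<^sup>2 \<noteq> 0" using t by (auto simp: add_eq_0_iff)
  qed
  \<comment> \<open>If \<open>t (1 - t)\<close> were a side vector other than \<open>- 1 - t\<close>, then \<open>t\<^sup>2 = 1\<close> or \<open>t\<^sup>2 = -1\<close>.\<close>
  have double_A: "t\<^sup>2 = 2 * t + 1" if "?r (t - t\<^sup>2) = 2"
  proof -
    have "(t - 1) * (t - 1) = 0 \<or> (t - 1) * (t + 1) = 0 \<or> t\<^sup>2 = - 1 \<or> t\<^sup>2 = 2 * t + 1"
      using r_2[OF nz(2) that] by (elim insertE emptyE) algebra+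
    then show ?thesis using t assms(2) by (auto simp: add_eq_0_iff2)
  qed
  have double_B: "t\<^sup>2 = 1 - 2 * t" if "?r (t + t\<^sup>2) = 2"
  proof -
    have "(t + 1) * (t + 1) = 0 \<or> (t - 1) * (t + 1) = 0 \<or> t\<^sup>2 = - 1 \<or> t\<^sup>2 = 1 - 2 * t"
      using r_2[OF nz(3) that] by (elim insertE emptyE) algebra+
    then show ?thesis using t assms(2) by (auto simp: add_eq_0_iff2)
  qed
  \<comment> \<open>Reduction by the quadratic equation makes \<open>t (1 + t)\<close> linear in \<open>t\<close>, so equating it
    to a difference is a linear condition with rational coefficients; its solutions are rational,
    but the quadratic equation has no rational root.\<close>
  have no_A: "?r (t + t\<^sup>2) = 0" if q: "t\<^sup>2 = 2 * t + 1"
  proof (rule ccontr)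
    assume "?r (t + t\<^sup>2) \<noteq> 0"
    from r_1[OF nz(3) this] have val: "t \<in> {1/3, -1, -1/5, 0, -1/2}"
      unfolding q by (auto simp: complex_eq_iff)
    show False
      by (insert q val, elim insertE emptyE; hypsubst; simp add: power2_eq_square)
  qed
  have no_B: "?r (t - t\<^sup>2) = 0" if q: "t\<^sup>2 = 1 - 2 * t"
  proof (rule ccontr)
    assume "?r (t - t\<^sup>2) \<noteq> 0"
    from r_1[OF nz(2) this] have val: "t \<in> {-1/3, 1, 1/5, 0, 1/2}"
      unfolding q by (auto simp: complex_eq_iff)
    show False
      by (insert q val, elim insertE emptyE; hypsubst; simp add: power2_eq_square)
  qed
  have AB: "?r (t - t\<^sup>2) + ?r (t + t\<^sup>2) \<le> 2"
    using double_A double_B no_A no_B r_le[OF nz(2)] r_le[OF nz(3)] by linarith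
  have "relations (t, - t, -1, 1) ?S
      = {((x, y), (z, u)) \<in> (?S \<times> ?S) \<times> (?S \<times> ?S). z - u = t * (x - y)}"
  proof -
    have "t * x + - t * y + - 1 * z + 1 * u = 0 \<longleftrightarrow> z - u = t * (x - y)" for x y z u
      by (rule iffI) algebra+
    then show ?thesis unfolding relations_def prod.case by simp
  qed
  then have "card (relations (t, - t, -1, 1) ?S) = (\<Sum>x\<in>?S. \<Sum>y\<in>?S. ?r (t * (x - y)))"
    using card_quadruples[of ?S "\<lambda>x y z u. z - u = t * (x - y)"] by (simp add: diff_count_def)
  also have "\<dots> = 16 + 2 * (?r (2 * t) + ?r (2 * t\<^sup>2)) + 4 * (?r (t - t\<^sup>2) + ?r (t + t\<^sup>2))"
  proof -
    have "?r (- t - t\<^sup>2) = ?r (t + t\<^sup>2)" "?r (t\<^sup>2 - t) = ?r (t - t\<^sup>2)"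
      using diff_count_minus[of ?S "t + t\<^sup>2"] diff_count_minus[of ?S "t - t\<^sup>2"] by simp_all
    moreover have "?r 0 = 4" using dist by (simp add: diff_count_0)
    ultimately show ?thesis
      using sum_differences[OF dist, of "\<lambda>e. ?r (t * e)"]
      by (simp add: diff_count_minus algebra_simps power2_eq_square)
  qed
  also have "?r (2 * t) = 1" using gen t by (subst r) auto
  also have "16 + 2 * (1 + ?r (2 * t\<^sup>2)) + 4 * (?r (t - t\<^sup>2) + ?r (t + t\<^sup>2)) \<le> 30"
  proof -
    have "16 + 2 * (1 + k) + 4 * (l + m) \<le> 30" if "k \<le> 2" "l + m \<le> 2" for k l m :: nat
      using that by (simp add: algebra_simps)
    from this[OF r_le[OF nz(1)] AB] show ?thesis by simp
  qed
  finally have "card (relations (t, - t, -1, 1) ?S) \<le> 30" by simp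
  moreover have "card (quad_endos ?S) + 5 \<le> card (relations (t, - t, -1, 1) ?S)"
    by (rule quad_endos_bound[OF dist]) (simp_all add: power2_eq_square)
  ultimately show ?thesis by simp
qed

section \<open>The square\<close>

text \<open>
  On the fourth roots of unity interpolation is the discrete Fourier transform: a value tuple
  comes from a polynomial of degree at most \<open>2\<close> when its Fourier coefficient at \<open>x\<^sup>3\<close> vanishes, and
  the degree is exactly \<open>2\<close> when the coefficient at \<open>x\<^sup>2\<close> does not. There are \<open>28\<close> such tuples.
\<close>

lemma card_quad_endos_mu4: "card (quad_endos (set mu4)) = 28"
proof -
  define S where "S = {1, \<i>, -1, - \<i>}"
  define T where "T = {((x, y), (z, u)) \<in> (S \<times> S) \<times> (S \<times> S).
    x + \<i> * y - z - \<i> * u = 0 \<and> x + z \<noteq> y + u}"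
  define ev where "ev f = ((poly f 1, poly f \<i>), (poly f (-1), poly f (- \<i>)))" for f
  define interp where "interp = (\<lambda>((x, y), (z, u)).
    [:(x + y + z + u) / 4, (x - \<i> * y - z + \<i> * u) / 4, (x - y + z - u) / 4:])"
  have "bij_betw ev (quad_endos S) T"
  proof (rule bij_betw_byWitness[where f' = interp])
    have "interp (ev f) = f" "ev f \<in> T" if f: "f \<in> quad_endos S" for f
    proof -
      have deg: "degree f = 2" and mem: "poly f ` S \<subseteq> S" using f by (auto simp: quad_endos_def)
      define p q r where pqr: "p = coeff f 0" "q = coeff f 1" "r = coeff f 2"
      have feq: "f = [:p, q, r:]"
      proof (rule poly_eqI)
        fix n show "coeff f n = coeff [:p, q, r:] n"
          using deg pqr by (auto simp: coeff_pCons numeral_2_eq_2 coeff_eq_0 split: nat.split)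
      qed
      have "r \<noteq> 0" using deg pqr by (metis leading_coeff_0_iff degree_0 zero_neq_numeral)
      have ev: "ev f = ((p + q + r, p + \<i> * q - r), (p - q + r, p - \<i> * q - r))"
        by (simp add: ev_def feq algebra_simps)
      show "interp (ev f) = f" unfolding ev interp_def by (simp add: feq algebra_simps)
      have "poly f 1 \<in> S" "poly f \<i> \<in> S" "poly f (-1) \<in> S" "poly f (- \<i>) \<in> S"
        using mem by (simp_all add: S_def)
      moreover have "p + q + r + \<i> * (p + \<i> * q - r) - (p - q + r) - \<i> * (p - \<i> * q - r) = 0"
        by (simp add: algebra_simps)
      moreover have "p + q + r + (p - q + r) \<noteq> p + \<i> * q - r + (p - \<i> * q - r)"
        using \<open>r \<noteq> 0\<close> by (simp add: algebra_simps)
      ultimately show "ev f \<in> T"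
        using ev unfolding T_def ev_def by simp
    qed
    then show "\<forall>f\<in>quad_endos S. interp (ev f) = f" "ev ` quad_endos S \<subseteq> T" by auto
    have "ev (interp y) = y \<and> interp y \<in> quad_endos S" if "y \<in> T" for y
    proof -
      obtain v1 v2 v3 v4 where y: "y = ((v1, v2), (v3, v4))" by (metis surj_pair)
      have v: "v1 \<in> S" "v2 \<in> S" "v3 \<in> S" "v4 \<in> S"
        and rel: "v1 + \<i> * v2 - v3 - \<i> * v4 = 0" and ne: "v1 + v3 \<noteq> v2 + v4"
        using that unfolding T_def y by simp_all
      have v3: "v3 = v1 + \<i> * v2 - \<i> * v4" using rel by (simp add: algebra_simps)
      have ev: "ev (interp y) = y"
        unfolding y ev_def interp_def v3 by (simp add: field_simps)
      moreover have "degree (interp y) = 2"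
        using ne by (simp add: y interp_def algebra_simps)
      moreover have "poly (interp y) ` S \<subseteq> S"
        using ev v unfolding ev_def y prod.inject by (simp add: S_def)
      ultimately show ?thesis by (simp add: quad_endos_def)
    qed
    then show "\<forall>y\<in>T. ev (interp y) = y" "interp ` T \<subseteq> quad_endos S" by auto
  qed
  then have "card (quad_endos S) = card T" by (rule bij_betw_same_card)
  also have "\<dots> = 28"
    unfolding T_def S_def
    by (subst card_quadruples, simp, subst card_pairs, simp) (simp add: complex_eq_iff)
  finally show ?thesis by (simp add: mu4_def S_def)
qed

section \<open>Affine normal forms and the classification\<close>

lemma four_element_set:
  assumes "card S = 4" "{a, b, c} \<subseteq> S" "distinct [a, b, c]"
  obtains d where "S = {a, b, c, d}" "d \<notin> {a, b, c}"
proof -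
  have fin: "finite S" using assms(1) by (simp add: card_ge_0_finite)
  have "card (S - {a, b, c}) = 1"
    using assms fin by (subst card_Diff_subset) auto
  then obtain d where d: "S - {a, b, c} = {d}" by (rule card_1_singletonE)
  show thesis by (rule that[of d]) (use d assms(2) in blast)+
qed

text \<open>
  The middle term \<open>y\<close> is the origin and the common difference the unit of the new coordinate.
\<close>

lemma progression_affine_normal_form:
  fixes S :: "complex set"
  assumes "card S = 4" "x \<in> S" "y \<in> S" "z \<in> S" "x + z = 2 * y" "x \<noteq> y"
  obtains a b t where "a \<noteq> 0" "S = (\<lambda>u. a * u + b) ` {-1, 0, 1, t}" "t \<notin> {0, 1, -1}"
proof -
  have x: "x = y - (z - y)" and "z \<noteq> y" using assms(5,6) by (auto simp: algebra_simps)
  have "x \<noteq> z" using assms(5,6) by auto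
  then obtain d where S: "S = {x, y, z, d}" and d: "d \<notin> {x, y, z}"
    using four_element_set[OF assms(1), of x y z] assms \<open>z \<noteq> y\<close> by auto
  define t where "t = (d - y) / (z - y)"
  have dt: "d = (z - y) * t + y" using \<open>z \<noteq> y\<close> by (simp add: t_def)
  show thesis
  proof (rule that[of "z - y" y t])
    show "z - y \<noteq> 0" using \<open>z \<noteq> y\<close> by simp
    show "S = (\<lambda>u. (z - y) * u + y) ` {-1, 0, 1, t}" by (simp add: S dt x)
    show "t \<notin> {0, 1, -1}" using d unfolding dt x by auto
  qed
qed

text \<open>
  The common midpoint of the two diagonals becomes the origin and one diagonal becomes
  \<open>{1, -1}\<close>.
\<close>

lemma parallelogram_affine_normal_form:
  fixes S :: "complex set"
  assumes "card S = 4" "x \<in> S" "y \<in> S" "z \<in> S" "u \<in> S" "x + y = z + u" "distinct [x, y, z, u]"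
  obtains a b t where "a \<noteq> 0" "S = (\<lambda>v. a * v + b) ` {1, -1, t, - t}"
proof -
  obtain d where S: "S = {x, y, z, d}"
    using four_element_set[OF assms(1), of x y z] assms by auto
  then have S: "S = {x, y, z, u}" using assms(5,7) by auto
  define a b t where abt: "a = (x - y) / 2" "b = (x + y) / 2" "t = (z - b) / a"
  have "a \<noteq> 0" using assms(7) by (simp add: abt)
  then have "z = a * t + b" by (simp add: abt(3))
  moreover have "x = a * 1 + b" "y = a * (-1) + b" by (simp_all add: abt(1,2) field_simps)
  moreover have "u = a * (- t) + b"
    using \<open>z = a * t + b\<close> assms(6) by (simp add: abt(2) field_simps)
  ultimately have "S = (\<lambda>v. a * v + b) ` {1, -1, t, - t}"
    unfolding S by (simp only: image_insert image_empty)
  with \<open>a \<noteq> 0\<close> show thesis by (rule that)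
qed

lemma affine_equivI:
  assumes "a \<noteq> 0" "S = (\<lambda>u. a * u + b) ` A"
  shows "affine_equiv A S"
  unfolding affine_equiv_def using assms by blast

text \<open>
  The three cases depend on the nontrivial solutions of \<open>x + y = z + u\<close> in \<open>S\<close>: a solution with
  \<open>z = u\<close> is a progression, a solution in four distinct points is a parallelogram (possibly flat),
  and without solutions all nonzero differences are distinct. Treating progressions first ensures
  that a parallelogram has no degenerate coincidences between sides and diagonals.
\<close>

lemma quad_endos_lt_28_or_square:
  assumes S: "card S = 4"
  shows "card (quad_endos S) < 28 \<or> affine_equiv (set mu4) S"
proof (cases "\<exists>x\<in>S. \<exists>y\<in>S. \<exists>z\<in>S. x + z = 2 * y \<and> x \<noteq> y")
  case True
  then obtain a b t where "a \<noteq> 0" and img: "S = (\<lambda>u. a * u + b) ` {-1, 0, 1, t}"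
    and "t \<notin> {0, 1, -1}"
    using progression_affine_normal_form[OF S] by metis
  then have "card (quad_endos S) \<le> 27"
    unfolding img card_quad_endos_affine[OF \<open>a \<noteq> 0\<close>] by (intro quad_endos_progression)
  then show ?thesis by simp
next
  case no_progression: False
  show ?thesis
  proof (cases "\<exists>x\<in>S. \<exists>y\<in>S. \<exists>z\<in>S. \<exists>u\<in>S. x + y = z + u \<and> distinct [x, y, z, u]")
    case True
    then obtain a b t where a: "a \<noteq> 0" and img: "S = (\<lambda>v. a * v + b) ` {1, -1, t, - t}"
      using parallelogram_affine_normal_form[OF S] by metis
    have in_S: "a * v + b \<in> S" if "v \<in> {1, -1, t, - t}" for v using that img by blast
    have np: False if "v \<in> {1, -1, t, - t}" "w \<in> {1, -1, t, - t}" "x \<in> {1, -1, t, - t}"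
      "v + x = 2 * w" "v \<noteq> w" for v w x
    proof -
      have "(a * v + b) + (a * x + b) = a * (v + x) + 2 * b" by (simp add: algebra_simps)
      also have "\<dots> = 2 * (a * w + b)" by (simp add: that(4) algebra_simps)
      finally have "(a * v + b) + (a * x + b) = 2 * (a * w + b)" .
      moreover have "a * v + b \<noteq> a * w + b" using a that(5) by simp
      ultimately show False
        using no_progression in_S[OF that(1)] in_S[OF that(2)] in_S[OF that(3)] by blast
    qed
    have "inj_on (\<lambda>v. a * v + b) {1, -1, t, - t}" using a by (simp add: inj_on_def)
    then have "card {1, -1, t, - t} = card S" unfolding img by (rule card_image[symmetric])
    also have "\<dots> = 4" by (rule S)
    finally have t0: "t \<notin> {0, 1, -1}" by (auto simp: insert_commute)
    have "t \<noteq> 3" "t \<noteq> -3" using np[of t 1 "-1"] np[of "- t" 1 "-1"] by auto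
    moreover have "3 * t \<noteq> 1"
    proof
      assume "3 * t = 1"
      then have "1 + - t = 2 * t" by algebra
      then show False using np[of 1 t "- t"] t0 by simp
    qed
    moreover have "3 * t \<noteq> -1"
    proof
      assume "3 * t = -1"
      then have "1 + t = 2 * (- t)" by algebra
      moreover have "1 \<noteq> - t" using t0 by (auto simp: complex_eq_iff)
      ultimately show False using np[of 1 "- t" t] by simp
    qed
    ultimately have t: "t \<notin> {3, -3, 1/3, -1/3}" by (auto simp: mult.commute)
    show ?thesis
    proof (cases "t\<^sup>2 = -1")
      case True
      then have "t = \<i> \<or> t = - \<i>" by (metis power2_eq_iff power2_i)
      then have "{1, -1, t, - t} = set mu4" by (auto simp: mu4_def)
      then show ?thesis using affine_equivI[OF a img] by simp
    next
      case False
      then have "card (quad_endos S) \<le> 27"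
        unfolding img card_quad_endos_affine[OF a] using t0 t
        by (intro quad_endos_parallelogram) auto
      then show ?thesis by simp
    qed
  next
    case False
    have "energy S \<le> 28"
    proof (rule energy_le_28[OF S], rule ccontr)
      fix a b c d assume m: "a \<in> S" "b \<in> S" "c \<in> S" "d \<in> S" and eq: "a - b = c - d"
        and ne: "\<not> (a = b \<or> a = c)"
      have sum: "a + d = b + c" "b + c = a + d" using eq by (simp_all add: algebra_simps)
      have "a \<noteq> d"
        using no_progression m sum ne by (metis mult_2)
      moreover have "b \<noteq> c"
        using no_progression m sum ne by (metis mult_2)
      ultimately have "distinct [a, d, b, c]" using ne eq by auto
      then show False using False m sum by blast
    qed
    moreover obtain a b c d where "S = {a, b, c, d}" "distinct [a, b, c, d]"
      using S by (auto simp: card_Suc_eq numeral_eq_Suc)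
    ultimately show ?thesis using quad_endos_le_energy[of a b c d] by simp
  qed
qed

theorem proposition4p1:
  shows "(\<forall>q\<in>Conf 4. finite (Endo 2 q) \<and> card (Endo 2 q) \<le> 28)
    \<and> E_max 4 2 = 28
    \<and> mu4 \<in> Conf 4
    \<and> (\<forall>q\<in>Conf 4. card (Endo 2 q) = E_max 4 2 \<longleftrightarrow> affine_equiv (set mu4) (set q))"
proof -
  have Endo: "Endo 2 q = quad_endos (set q)" for q by (simp add: Endo_def quad_endos_def)
  have mu4: "mu4 \<in> Conf 4" by (auto simp: mu4_def Conf_def complex_eq_iff)
  have square: "card (Endo 2 q) = 28" if "affine_equiv (set mu4) (set q)" for q
    using that card_quad_endos_affine card_quad_endos_mu4 unfolding Endo affine_equiv_def by metis
  have lt: "card (Endo 2 q) < 28" if "q \<in> Conf 4" "\<not> affine_equiv (set mu4) (set q)" for q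
    using that quad_endos_lt_28_or_square[of "set q"]
    by (simp add: Endo Conf_def distinct_card)
  have le: "card (Endo 2 q) \<le> 28" if "q \<in> Conf 4" for q
    using square lt[OF that] by fastforce
  have fin: "finite (Endo 2 q)" if "q \<in> Conf 4" for q
  proof -
    obtain a b c d where q: "q = [a, b, c, d]" and "distinct [a, b, c, d]"
      using \<open>q \<in> Conf 4\<close> by (auto simp: Conf_def length_Suc_conv numeral_eq_Suc)
    \<comment> \<open>Zero weights suffice for finiteness: they impose no relation on the value tuples.\<close>
    then have "finite (quad_endos {a, b, c, d})"
      by (intro quad_endos_count(1)[of a b c d 0 0 0 0 "{}"]) auto
    then show ?thesis by (simp add: Endo q)
  qed
  have "E_max 4 2 = 28"
    unfolding E_max_def
  proof (rule Max_eqI)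
    have "(\<lambda>q. card (Endo 2 q)) ` Conf 4 \<subseteq> {..28}" using le by auto
    then show "finite ((\<lambda>q. card (Endo 2 q)) ` Conf 4)" by (rule finite_subset) simp
    show "28 \<in> (\<lambda>q. card (Endo 2 q)) ` Conf 4"
      using mu4 by (intro image_eqI[of _ _ mu4]) (simp_all add: Endo card_quad_endos_mu4)
  qed (use le in auto)
  then show ?thesis using fin le mu4 square lt by fastforce
qed

end
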